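(* Let $G$ be a $d$-regular graph on $n$ vertices with $\lambda(G)<d$, and let $f$ be any eigenvector of its adjacency matrix $A_G$. Let $C_1$ and $C_2$ be the two largest nodal domains of $f$ (by number of vertices, with $|C_2|:=0$ if $f$ has only one nodal domain). Then $$|C_1|+|C_2|\ \ge\ \left(1-\frac{2\lambda(G)}{d-\lambda(G)}\right)n.$$
   Context: Graphs are finite and simple. For a graph $G$ on $n$ vertices let $\lambda_1(G)\ge\lambda_2(G)\ge\dots\ge\lambda_n(G)$ be the eigenvalues of its adjacency matrix $A_G$; the spectral expansion of $G$ is $\lambda(G):=\max\{\lambda_2(G),-\lambda_n(G)\}$. A (weak) nodal domain of $f:V(G)\to\mathbb{R}$ on $G$ is a maximal connected subgraph $S$ of $G$ such that $f(u)\ge 0$ for all $u\in S$ or $f(u)\le 0$ for all $u\in S$; $|S|$ denotes its number of vertices. *)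

theory Defs
  imports
    "Graph_Theory.Graph_Theory"
    "Jordan_Normal_Form.Char_Poly"
    "HOL-Library.Multiset"
begin

text \<open>
  Finite simple graphs are the digraphs satisfying \<^locale>\<open>pair_graph\<close> (finite, symmetric, without
  loops; each edge is a pair of opposite arcs), so the out-degree is the number of neighbours.
\<close>

definition regular_graph :: "'a pair_pre_digraph \<Rightarrow> nat \<Rightarrow> bool" where
  "regular_graph G d \<longleftrightarrow> (\<forall>v \<in> pverts G. out_degree (with_proj G) v = d)"

text \<open>
  A matrix needs an ordering of the vertices; the list \<open>vs\<close> below is any enumeration of the vertex
  set without repetitions. Different enumerations give permutation-similar matrices.
\<close>

definition vertex_enum :: "'a pair_pre_digraph \<Rightarrow> 'a list \<Rightarrow> bool" where
  "vertex_enum G vs \<longleftrightarrow> distinct vs \<and> set vs = pverts G"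

definition adj_mat :: "'a pair_pre_digraph \<Rightarrow> 'a list \<Rightarrow> real mat" where
  "adj_mat G vs = mat (length vs) (length vs)
     (\<lambda>(i, j). if (vs ! i, vs ! j) \<in> parcs G then 1 else 0)"

definition adj_eigenvector :: "'a pair_pre_digraph \<Rightarrow> 'a list \<Rightarrow> ('a \<Rightarrow> real) \<Rightarrow> bool" where
  "adj_eigenvector G vs f \<longleftrightarrow>
     (\<exists>\<mu>. eigenvector (adj_mat G vs) (vec (length vs) (\<lambda>i. f (vs ! i))) \<mu>)"

text \<open>
  \<open>graph_eig G vs k\<close> is the \<open>k\<close>-th largest adjacency eigenvalue, counted from 1 and with
  multiplicity. It is meaningful for k between 1 and the number n of vertices: the matrix is real
  symmetric, so its characteristic polynomial has n real roots.
\<close>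

definition graph_eig :: "'a pair_pre_digraph \<Rightarrow> 'a list \<Rightarrow> nat \<Rightarrow> real" where
  "graph_eig G vs k = rev (sorted_list_of_multiset (proots (char_poly (adj_mat G vs)))) ! (k - 1)"

text \<open>
  For a single vertex the second eigenvalue does not exist and \<open>graph_eig G vs 2\<close> is unspecified, but
  the maximum is still at least \<open>- graph_eig G vs 1 = 0\<close>, the degree; so a hypothesis that the
  spectral expansion is smaller than the degree excludes this case.
\<close>

definition spectral_expansion :: "'a pair_pre_digraph \<Rightarrow> 'a list \<Rightarrow> real" where
  "spectral_expansion G vs = max (graph_eig G vs 2) (- graph_eig G vs (card (pverts G)))"

text \<open>
  A maximal subgraph with the property below is an induced subgraph, because adding arcs of \<open>G\<close>
  between its vertices preserves the property; in particular it is again symmetric. The library's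
  \<^const>\<open>connected\<close> includes that there is at least one vertex.
\<close>

definition nodal_domains ::
  "'a pair_pre_digraph \<Rightarrow> ('a \<Rightarrow> real) \<Rightarrow> ('a, 'a \<times> 'a) pre_digraph set" where
  "nodal_domains G f =
     {S. pre_digraph.max_subgraph (with_proj G)
           (\<lambda>H. connected H \<and> ((\<forall>u \<in> verts H. f u \<ge> 0) \<or> (\<forall>u \<in> verts H. f u \<le> 0))) S}"

text \<open>
  \<open>nodal_domain_size G f k\<close> is the number of vertices of the \<open>k\<close>-th largest nodal domain, counted
  from 1, and 0 if there are fewer than \<open>k\<close> nodal domains. Distinct domains of equal size are
  counted separately.
\<close>

definition nodal_domain_size :: "'a pair_pre_digraph \<Rightarrow> ('a \<Rightarrow> real) \<Rightarrow> nat \<Rightarrow> nat" where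
  "nodal_domain_size G f k =
     (let sizes = rev (sorted_list_of_multiset
                    (image_mset (\<lambda>S. card (verts S)) (mset_set (nodal_domains G f))))
      in if k \<le> length sizes then sizes ! (k - 1) else 0)"

end

theory Submission
  imports Defs "HOL-Analysis.Function_Topology"
begin

text \<open>
  Every set \<open>U\<close> of vertices satisfies the expander mixing bound
  \<open>\<bar>n e(U) - d |U|\<^sup>2\<bar> \<le> \<lambda> |U| (n - |U|)\<close>, where \<open>e(U)\<close> counts the arcs inside \<open>U\<close>. If all components
  of the subgraph induced on \<open>U\<close> have at most \<open>m\<close> vertices, then adding the upper bounds for the
  components and comparing with the lower bound for \<open>U\<close> gives
  \<open>(d - \<lambda>) m \<ge> (d + \<lambda>) |U| - 2 \<lambda> n\<close>. The components of \<open>{f \<ge> 0}\<close> and \<open>{f \<le> 0}\<close> are nodal domains, and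
  these two sets cover the graph, so the two instances of this inequality add up to
  \<open>(d - \<lambda>) (|C\<^sub>1| + |C\<^sub>2|) \<ge> (d - 3 \<lambda>) n\<close>.
\<close>

section \<open>Entries of a multiset listed in decreasing order\<close>

lemma sorted_desc_nth_le:
  assumes "a \<in># M"
  shows "a \<le> rev (sorted_list_of_multiset M) ! 0"
    and "rev (sorted_list_of_multiset M) ! (size M - 1) \<le> a"
proof -
  let ?xs = "sorted_list_of_multiset M"
  have len: "length ?xs = size M"
    by (metis mset_sorted_list_of_multiset size_mset)
  have "a \<in> set ?xs" using assms by (metis mset_sorted_list_of_multiset set_mset_mset)
  then obtain i where i: "i < length ?xs" "?xs ! i = a"
    by (auto simp only: in_set_conv_nth)
  have "rev ?xs ! 0 = ?xs ! (length ?xs - 1)" "rev ?xs ! (size M - 1) = ?xs ! 0"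
    using i(1) len by (simp_all add: rev_nth)
  moreover have "?xs ! i \<le> ?xs ! (length ?xs - 1)" "?xs ! 0 \<le> ?xs ! i"
    using i(1) by (auto intro!: sorted_nth_mono[OF sorted_sorted_list_of_multiset])
  ultimately show "a \<le> rev ?xs ! 0" "rev ?xs ! (size M - 1) \<le> a"
    using i(2) by simp_all
qed

text \<open>The submultiset hypothesis counts multiplicity: for \<open>a = b\<close> it asks for two
  copies. Hence a repeated eigenvalue, or two domains of equal size, still bound the second
  entry.\<close>

lemma sorted_desc_first_two:
  assumes "{#a, b#} \<subseteq># M"
  shows "min a b \<le> rev (sorted_list_of_multiset M) ! 1"
    and "max a b \<le> rev (sorted_list_of_multiset M) ! 0"
    and "2 \<le> size M"
proof -
  let ?xs = "sorted_list_of_multiset M"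
  have len: "length ?xs = size M"
    by (metis mset_sorted_list_of_multiset size_mset)
  show 2: "2 \<le> size M" using size_mset_mono[OF assms] by simp
  show "max a b \<le> rev ?xs ! 0"
    using sorted_desc_nth_le(1)[of a M] sorted_desc_nth_le(1)[of b M] mset_subset_eqD[OF assms]
    by simp
  obtain x y zs where xs: "rev ?xs = x # y # zs"
    using 2 len by (metis Suc_le_length_iff length_rev numeral_2_eq_2)
  have "sorted (rev (x # y # zs))"
    using sorted_sorted_list_of_multiset[of M] xs by (metis rev_rev_ident)
  then have le: "z \<le> y" if "z \<in> set zs" for z using that by (auto simp: sorted_append)
  have "M = mset (rev ?xs)" by simp
  also have "\<dots> = {#x, y#} + mset zs" unfolding xs by simp
  finally have M: "M = {#x, y#} + mset zs" .
  show "min a b \<le> rev ?xs ! 1"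
  proof (rule ccontr)
    assume "\<not> ?thesis"
    then have "y < min a b" unfolding xs by (simp only: nth_Cons_Suc nth_Cons_0 One_nat_def not_le)
    then have "y < a" "y < b" by simp_all
    \<comment> \<open>All entries after \<open>x\<close> are at most \<open>y\<close>, so
      \<open>x\<close> is the only possible occurrence of \<open>a\<close> and of \<open>b\<close>,
      with multiplicity one; two copies do not fit.\<close>
    then have "count M a = (if x = a then 1 else 0)" "count M b = (if x = b then 1 else 0)"
      using le[of a] le[of b] by (auto simp: M count_eq_zero_iff)
    moreover have "count {#a, b#} a \<le> count M a" "count {#a, b#} b \<le> count M b"
      using assms by (simp_all only: mset_subset_eq_count)
    ultimately show False by (auto split: if_splits)
  qed
qed

section \<open>Rayleigh quotients orthogonal to the constant vector\<close>

text \<open>Near \<open>t = 0\<close> the linear term dominates and changes sign with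
  \<open>t\<close>. This is the first-order condition for the maximizer of the Rayleigh quotient, in
  a form free of derivatives.\<close>

lemma nonneg_quadratic_linear_coeff:
  fixes b c :: real
  assumes "\<And>t. 0 \<le> 2 * t * b + t\<^sup>2 * c"
  shows "b = 0"
proof (rule ccontr)
  assume b: "b \<noteq> 0"
  have c: "c \<ge> 0" using assms[of 1] assms[of "-1"] by simp
  \<comment> \<open>The minimizer would be \<open>- b / c\<close>; the denominator
    \<open>c + 1\<close> also covers \<open>c = 0\<close> and still makes the value
    negative.\<close>
  define t where "t = - b / (c + 1)"
  have t: "t * (c + 1) = - b" using c by (simp add: t_def)
  have "0 \<le> (2 * t * b + t\<^sup>2 * c) * (c + 1)\<^sup>2"
    using assms[of t] by simp
  also have "\<dots> = 2 * (t * (c + 1)) * b * (c + 1) + (t * (c + 1))\<^sup>2 * c"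
    by (simp add: power2_eq_square algebra_simps)
  also have "\<dots> = - (b\<^sup>2 * (c + 2))"
    unfolding t by (simp add: power2_eq_square algebra_simps)
  finally show False using b c
    by (smt (verit) mult_pos_pos zero_less_power2)
qed

text \<open>The kernel is a function on pairs rather than a matrix, so that the same lemmas serve
  matrix indices and vertices.\<close>

definition quad_form :: "'a set \<Rightarrow> ('a \<Rightarrow> 'a \<Rightarrow> real) \<Rightarrow> ('a \<Rightarrow> real) \<Rightarrow> real" where
  "quad_form V a x = (\<Sum>i\<in>V. \<Sum>j\<in>V. a i j * x i * x j)"

lemma quad_form_cong:
  assumes "\<And>i j. i \<in> V \<Longrightarrow> j \<in> V \<Longrightarrow> a i j = b i j" "\<And>i. i \<in> V \<Longrightarrow> x i = y i"
  shows "quad_form V a x = quad_form V b y"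
  using assms by (simp add: quad_form_def cong: sum.cong)

lemma quad_form_scale: "quad_form V a (\<lambda>i. c * x i) = c\<^sup>2 * quad_form V a x"
  by (simp add: quad_form_def sum_distrib_left power2_eq_square algebra_simps)

text \<open>Symmetry merges the two mixed sums. The expansion serves both to vary the maximizer and
  to shift an indicator function by a constant.\<close>

lemma quad_form_add_scaled:
  assumes sym: "\<And>i j. i \<in> V \<Longrightarrow> j \<in> V \<Longrightarrow> a i j = a j i"
  shows "quad_form V a (\<lambda>i. y i + t * w i) = quad_form V a y
    + 2 * t * (\<Sum>i\<in>V. (\<Sum>j\<in>V. a i j * y j) * w i) + t\<^sup>2 * quad_form V a w"
proof -
  let ?S = "\<lambda>g. \<Sum>i\<in>V. \<Sum>j\<in>V. g i j"
  have "?S (\<lambda>i j. a i j * y i * w j) = ?S (\<lambda>i j. a j i * y j * w i)"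
    by (rule sum.swap)
  also have "\<dots> = ?S (\<lambda>i j. a i j * y j * w i)"
    using sym by (intro sum.cong refl) simp
  finally have eq: "?S (\<lambda>i j. a i j * y i * w j) = ?S (\<lambda>i j. a i j * y j * w i)" .
  have "quad_form V a (\<lambda>i. y i + t * w i) =
      ?S (\<lambda>i j. a i j * y i * y j + t * (a i j * y i * w j) + t * (a i j * y j * w i)
         + t\<^sup>2 * (a i j * w i * w j))"
    unfolding quad_form_def by (intro sum.cong refl) (simp add: algebra_simps power2_eq_square)
  also have "\<dots> = quad_form V a y + t * ?S (\<lambda>i j. a i j * y i * w j)
      + t * ?S (\<lambda>i j. a i j * y j * w i) + t\<^sup>2 * quad_form V a w"
    unfolding quad_form_def by (simp add: sum.distrib sum_distrib_left)
  finally show ?thesis unfolding eq by (simp add: sum_distrib_right)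
qed

text \<open>Coordinates outside \<open>V\<close> are pinned to 0, so the sphere is a closed part of
  a product of compact sets, and Tychonoff's theorem applies.\<close>

lemma compact_unit_sphere_sum_zero:
  fixes V :: "'a set"
  assumes "finite V"
  shows "compact {x :: 'a \<Rightarrow> real. (\<forall>i. i \<notin> V \<longrightarrow> x i = 0) \<and> (\<Sum>i\<in>V. x i) = 0
    \<and> (\<Sum>i\<in>V. (x i)\<^sup>2) = 1}" (is "compact ?K")
proof -
  let ?B = "PiE UNIV (\<lambda>i. if i \<in> V then {-1..1} else {0}) :: ('a \<Rightarrow> real) set"
  have "compactin (product_topology (\<lambda>_. euclidean) UNIV) ?B"
    by (subst compactin_PiE) auto
  then have "compact ?B" by (simp add: euclidean_product_topology)
  moreover have "closed {x :: 'a \<Rightarrow> real. (\<Sum>i\<in>V. x i) = 0 \<and> (\<Sum>i\<in>V. (x i)\<^sup>2) = 1}"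
    by (intro closed_Collect_conj closed_Collect_eq continuous_intros
        continuous_on_product_coordinates)
  ultimately have "compact (?B \<inter> {x. (\<Sum>i\<in>V. x i) = 0 \<and> (\<Sum>i\<in>V. (x i)\<^sup>2) = 1})"
    by (rule compact_Int_closed)
  moreover have "?K \<subseteq> ?B"
  proof
    fix x assume x: "x \<in> ?K"
    have "x i \<in> {-1..1}" if "i \<in> V" for i
    proof -
      have "(x i)\<^sup>2 \<le> (\<Sum>i\<in>V. (x i)\<^sup>2)"
        using assms that by (intro member_le_sum) auto
      then have "\<bar>x i\<bar> \<le> 1" using x by (simp add: abs_square_le_1)
      then show ?thesis by auto
    qed
    then show "x \<in> ?B" using x by (simp add: PiE_UNIV_domain Pi_iff)
  qed
  then have "?K = ?B \<inter> {x. (\<Sum>i\<in>V. x i) = 0 \<and> (\<Sum>i\<in>V. (x i)\<^sup>2) = 1}"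
    by (auto simp: PiE_UNIV_domain Pi_iff split: if_splits)
  ultimately show ?thesis by simp
qed

text \<open>The form attains its maximum on the compact unit sphere of the sum-zero hyperplane.
  Symmetry and constant row sums keep this hyperplane invariant, so the maximizer satisfies the
  eigenvalue equation exactly, with no extra multiple of the constant vector.\<close>

lemma rayleigh_maximizer_sum_zero:
  fixes V :: "'a set" and a :: "'a \<Rightarrow> 'a \<Rightarrow> real"
  assumes fin: "finite V" and card: "card V \<ge> 2"
    and sym: "\<forall>i\<in>V. \<forall>j\<in>V. a i j = a j i"
    and row: "\<forall>i\<in>V. (\<Sum>j\<in>V. a i j) = d"
  shows "\<exists>y M. (\<Sum>i\<in>V. y i) = 0 \<and> (\<Sum>i\<in>V. (y i)\<^sup>2) = 1 \<and>
    (\<forall>i\<in>V. (\<Sum>j\<in>V. a i j * y j) = M * y i) \<and>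
    (\<forall>x. (\<Sum>i\<in>V. x i) = 0 \<longrightarrow> quad_form V a x \<le> M * (\<Sum>i\<in>V. (x i)\<^sup>2))"
proof -
  define K where "K = {x :: 'a \<Rightarrow> real. (\<forall>i. i \<notin> V \<longrightarrow> x i = 0) \<and> (\<Sum>i\<in>V. x i) = 0
    \<and> (\<Sum>i\<in>V. (x i)\<^sup>2) = 1}"
  have K: "compact K" unfolding K_def by (rule compact_unit_sphere_sum_zero[OF fin])
  have normalize: "(\<lambda>i. inverse (sqrt (\<Sum>i\<in>V. (x i)\<^sup>2)) * (if i \<in> V then x i else 0)) \<in> K"
    if "(\<Sum>i\<in>V. x i) = 0" "(\<Sum>i\<in>V. (x i)\<^sup>2) \<noteq> 0" for x
  proof -
    let ?s = "\<Sum>i\<in>V. (x i)\<^sup>2"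
    have "?s > 0" using that(2) by (simp add: order_less_le sum_nonneg)
    then show ?thesis using that
      by (simp add: K_def power_mult_distrib sum_distrib_left[symmetric] power_inverse
          cong: sum.cong)
  qed
  obtain p q where pq: "p \<in> V" "q \<in> V" "p \<noteq> q"
    using card by (metis card_le_Suc0_iff_eq fin not_less_eq_eq numeral_2_eq_2)
  \<comment> \<open>A difference of two point indicators shows that the sphere is nonempty.\<close>
  define x0 where "x0 = (\<lambda>i. of_bool (i = p) - of_bool (i = q) :: real)"
  have "(\<Sum>i\<in>V. x0 i) = 0" using pq fin by (simp add: x0_def sum_subtractf of_bool_def)
  moreover have "(x0 p)\<^sup>2 \<le> (\<Sum>i\<in>V. (x0 i)\<^sup>2)"
    using fin pq by (intro member_le_sum) auto
  ultimately have "K \<noteq> {}" using normalize[of x0] pq by (auto simp: x0_def)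
  moreover have "continuous_on K (quad_form V a)"
    unfolding quad_form_def
    by (intro continuous_intros continuous_on_subset[OF continuous_on_product_coordinates]) auto
  ultimately obtain y where y: "y \<in> K" and max: "\<And>x. x \<in> K \<Longrightarrow> quad_form V a x \<le> quad_form V a y"
    using continuous_attains_sup[OF K] by blast
  define M where "M = quad_form V a y"
  have y0: "(\<Sum>i\<in>V. y i) = 0" and y1: "(\<Sum>i\<in>V. (y i)\<^sup>2) = 1" using y by (auto simp: K_def)
  have bound: "quad_form V a x \<le> M * (\<Sum>i\<in>V. (x i)\<^sup>2)" if x: "(\<Sum>i\<in>V. x i) = 0" for x
  proof (cases "(\<Sum>i\<in>V. (x i)\<^sup>2) = 0")
    case True
    then have "\<forall>i\<in>V. x i = 0" using fin by (simp add: sum_nonneg_eq_0_iff)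
    then have "quad_form V a x = 0" by (simp add: quad_form_def)
    then show ?thesis using True by simp
  next
    case False
    let ?s = "\<Sum>i\<in>V. (x i)\<^sup>2"
    have s: "?s > 0" using False by (simp add: order_less_le sum_nonneg)
    have "quad_form V a (\<lambda>i. if i \<in> V then x i else 0) = quad_form V a x"
      by (rule quad_form_cong) simp_all
    then have "(inverse (sqrt ?s))\<^sup>2 * quad_form V a x \<le> M"
      using max[OF normalize[OF x False]] by (simp only: quad_form_scale M_def)
    then show ?thesis using s by (simp add: power_inverse field_simps)
  qed
  \<comment> \<open>The residual of the eigenvalue equation sums to zero, so it is itself an
    admissible direction of variation. The linear coefficient along it is the sum of the squares of
    \<open>w\<close>, which must therefore vanish.\<close>
  define w where "w i = M * y i - (\<Sum>j\<in>V. a i j * y j)" for i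
  have w0: "(\<Sum>i\<in>V. w i) = 0"
  proof -
    have "(\<Sum>i\<in>V. \<Sum>j\<in>V. a i j * y j) = (\<Sum>j\<in>V. \<Sum>i\<in>V. a i j * y j)" by (rule sum.swap)
    also have "\<dots> = (\<Sum>j\<in>V. (\<Sum>i\<in>V. a j i) * y j)"
      unfolding sum_distrib_right using sym by (intro sum.cong refl) simp
    also have "\<dots> = d * (\<Sum>j\<in>V. y j)" using row by (simp add: sum_distrib_left)
    finally show ?thesis using y0
      by (simp add: w_def sum_subtractf sum_distrib_left[symmetric])
  qed
  have "(\<Sum>i\<in>V. (w i)\<^sup>2) = 0"
  proof (rule nonneg_quadratic_linear_coeff)
    fix t
    have sq: "(\<Sum>i\<in>V. (y i + t * w i)\<^sup>2) = 1 + 2 * t * (\<Sum>i\<in>V. y i * w i) + t\<^sup>2 * (\<Sum>i\<in>V. (w i)\<^sup>2)"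
      unfolding y1[symmetric]
      by (simp add: sum.distrib sum_distrib_left power2_eq_square algebra_simps)
    have "(\<Sum>i\<in>V. y i + t * w i) = 0"
      using y0 w0 by (simp add: sum.distrib sum_distrib_left[symmetric])
    then have "quad_form V a (\<lambda>i. y i + t * w i) \<le> M * (\<Sum>i\<in>V. (y i + t * w i)\<^sup>2)"
      by (rule bound)
    moreover have "quad_form V a (\<lambda>i. y i + t * w i) =
        M + 2 * t * (\<Sum>i\<in>V. (\<Sum>j\<in>V. a i j * y j) * w i) + t\<^sup>2 * quad_form V a w"
      unfolding M_def using sym by (intro quad_form_add_scaled) blast
    ultimately
    have "0 \<le> 2 * t * (M * (\<Sum>i\<in>V. y i * w i) - (\<Sum>i\<in>V. (\<Sum>j\<in>V. a i j * y j) * w i))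
        + t\<^sup>2 * (M * (\<Sum>i\<in>V. (w i)\<^sup>2) - quad_form V a w)"
      unfolding sq by (simp add: algebra_simps)
    also have "M * (\<Sum>i\<in>V. y i * w i) - (\<Sum>i\<in>V. (\<Sum>j\<in>V. a i j * y j) * w i) = (\<Sum>i\<in>V. (w i)\<^sup>2)"
      unfolding sum_distrib_left sum_subtractf[symmetric]
      by (intro sum.cong refl) (simp add: w_def power2_eq_square algebra_simps)
    finally show "0 \<le> 2 * t * (\<Sum>i\<in>V. (w i)\<^sup>2) + t\<^sup>2 * (M * (\<Sum>i\<in>V. (w i)\<^sup>2) - quad_form V a w)" .
  qed
  then have "w i = 0" if "i \<in> V" for i using fin that by (simp add: sum_nonneg_eq_0_iff)
  then have "(\<Sum>j\<in>V. a i j * y j) = M * y i" if "i \<in> V" for i using that by (simp add: w_def)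
  then show ?thesis using y0 y1 bound by blast
qed

section \<open>Eigenvalues of symmetric matrices\<close>

lemma quad_form_uminus: "quad_form V (\<lambda>i j. - a i j) x = - quad_form V a x"
  by (simp add: quad_form_def sum_negf)

lemma proots_prod_linear: "proots (\<Prod>a\<leftarrow>as. [:- a, 1:]) = mset (as :: 'a :: idom list)"
proof -
  have "0 \<notin> set (map (\<lambda>a. [:- a, 1:]) as)" by auto
  from proots_prod_list[OF this] show ?thesis by (simp add: o_def)
qed

text \<open>The characteristic polynomial splits over the complex numbers, and the Hermitian form
  \<open>h\<close> of an eigenvector is real by symmetry, which forces the eigenvalue to be real.
  The count identifies index \<open>n - 1\<close> of the sorted roots as the last one.\<close>

lemma size_proots_char_poly_symmetric:
  fixes A :: "real mat"
  assumes A: "A \<in> carrier_mat n n"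
    and sym: "\<And>i j. i < n \<Longrightarrow> j < n \<Longrightarrow> A $$ (i, j) = A $$ (j, i)"
  shows "size (proots (char_poly A)) = n"
proof -
  interpret p: map_poly_inj_idom_hom complex_of_real ..
  let ?B = "map_mat complex_of_real A"
  have B: "?B \<in> carrier_mat n n" using A by simp
  obtain as where as: "char_poly ?B = (\<Prod>a\<leftarrow>as. [:- a, 1:])" "length as = n"
    using char_poly_factorized[OF B] by blast
  have real: "complex_of_real (Re z) = z" if "z \<in> set as" for z
  proof -
    have "poly (char_poly ?B) z = 0"
      using that unfolding as(1) by (simp add: poly_prod_list prod_list_zero_iff)
    then have "eigenvalue ?B z" using eigenvalue_root_char_poly[OF B] by blast
    then obtain v where v: "v \<in> carrier_vec n" "v \<noteq> 0\<^sub>v n" "?B *\<^sub>v v = z \<cdot>\<^sub>v v"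
      using A by (auto simp: eigenvalue_def eigenvector_def)
    define x where "x i = v $ i" for i
    have ev: "(\<Sum>j<n. of_real (A $$ (i, j)) * x j) = z * x i" if "i < n" for i
      using arg_cong[OF v(3), of "\<lambda>w. w $ i"] that v(1) A
      by (simp add: scalar_prod_def x_def lessThan_atLeast0)
    define h where "h = (\<Sum>i<n. \<Sum>j<n. cnj (x i) * of_real (A $$ (i, j)) * x j)"
    define s where "s = (\<Sum>i<n. (cmod (x i))\<^sup>2)"
    have "h = (\<Sum>i<n. cnj (x i) * (z * x i))"
      unfolding h_def by (intro sum.cong refl) (simp add: ev[symmetric] sum_distrib_left mult.assoc)
    also have "\<dots> = z * of_real s"
      unfolding s_def of_real_sum sum_distrib_left
      by (intro sum.cong refl) (simp only: complex_norm_square mult_ac)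
    finally have h: "h = z * of_real s" .
    have "cnj h = (\<Sum>i<n. \<Sum>j<n. cnj (x j) * of_real (A $$ (i, j)) * x i)"
      unfolding h_def cnj_sum by (intro sum.cong refl) simp
    also have "\<dots> = (\<Sum>j<n. \<Sum>i<n. cnj (x j) * of_real (A $$ (i, j)) * x i)" by (rule sum.swap)
    also have "\<dots> = h" unfolding h_def using sym by (intro sum.cong refl) simp
    finally have "Im h = 0" by (metis Reals_cnj_iff complex_is_Real_iff)
    moreover obtain i where "i < n" "x i \<noteq> 0"
      using v(1,2) by (auto simp: x_def vec_eq_iff)
    then have "s > 0" unfolding s_def
      by (intro sum_pos2[of _ i]) auto
    ultimately have "Im z = 0" using h by simp
    then show ?thesis by (simp add: complex_eq_iff)
  qed
  \<comment> \<open>The embedding of real into complex polynomials is injective, so the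
    factorization descends.\<close>
  have "map_poly of_real (char_poly A) = char_poly ?B" by (rule of_real_hom.char_poly_hom[OF A, symmetric])
  also have "\<dots> = (\<Prod>a\<leftarrow>map (\<lambda>z. of_real (Re z)) as. [:- a, 1:])"
    using real by (simp add: as(1) map_idI)
  also have "\<dots> = map_poly of_real (\<Prod>a\<leftarrow>map Re as. [:- a, 1:])"
    by (simp add: p.hom_prod_list o_def)
  finally have "char_poly A = (\<Prod>a\<leftarrow>map Re as. [:- a, 1:])" by (simp only: p.eq_iff)
  then show ?thesis by (simp only: proots_prod_linear size_mset length_map as(2))
qed

text \<open>Adding all rows of \<open>X I - A\<close> to its first row makes that row constantly \<open>X - d\<close>. The cofactor
  that remains after dividing by \<open>X - d\<close> is singular at \<open>M\<close>, since its first row encodes \<open>\<Sum>y = 0\<close>.\<close>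
lemma proots_char_poly_two_eigenvalues:
  fixes A :: "real mat"
  assumes A: "A \<in> carrier_mat n n"
    and col: "\<And>j. j < n \<Longrightarrow> (\<Sum>i<n. A $$ (i, j)) = d"
    and y0: "(\<Sum>i<n. y i) = 0" and y1: "k < n" "y k \<noteq> 0"
    and ev: "\<And>i. i < n \<Longrightarrow> (\<Sum>j<n. A $$ (i, j) * y j) = M * y i"
  shows "{#d, M#} \<subseteq># proots (char_poly A)"
proof -
  let ?C = "char_poly_matrix A"
  have n: "0 < n" using y1 by simp
  have C: "?C \<in> carrier_mat n n" using A by simp
  \<comment> \<open>\<open>E\<close> performs the row operation and has determinant one;
    \<open>Q\<close> is what remains once \<open>X - d\<close> is taken out of row 0, and
    \<open>R\<close> is \<open>Q\<close> evaluated at \<open>M\<close>.\<close>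
  define E :: "real poly mat" where "E = mat n n (\<lambda>(i, j). if i = 0 \<or> i = j then 1 else 0)"
  define Q :: "real poly mat" where "Q = mat n n (\<lambda>(i, j). if i = 0 then 1 else ?C $$ (i, j))"
  define R :: "real mat" where
    "R = mat n n (\<lambda>(i, j). if i = 0 then 1 else (if i = j then M else 0) - A $$ (i, j))"
  have carr: "E \<in> carrier_mat n n" "Q \<in> carrier_mat n n" "R \<in> carrier_mat n n"
    by (simp_all add: E_def Q_def R_def)
  have Cij: "?C $$ (i, j) = (if i = j then [:0, 1:] else 0) - [:A $$ (i, j):]"
    if "i < n" "j < n" for i j
    using that A by (auto simp: char_poly_matrix_def)
  have EC: "E * ?C = multrow 0 [:- d, 1:] Q"
  proof (rule eq_matI)
    fix i j assume "i < dim_row (multrow 0 [:- d, 1:] Q)" "j < dim_col (multrow 0 [:- d, 1:] Q)"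
    then have ij: "i < n" "j < n" using carr by auto
    have "(E * ?C) $$ (i, j) = (\<Sum>l<n. E $$ (i, l) * ?C $$ (l, j))"
      using ij carr C by (simp add: scalar_prod_def lessThan_atLeast0)
    also have "\<dots> = multrow 0 [:- d, 1:] Q $$ (i, j)"
    proof (cases "i = 0")
      case True
      have "(\<Sum>l<n. E $$ (i, l) * ?C $$ (l, j)) =
          (\<Sum>l<n. (if l = j then [:0, 1:] else 0) - [:A $$ (l, j):])"
        using True ij n by (intro sum.cong refl) (simp add: E_def Cij)
      also have "\<dots> = [:0, 1:] - (\<Sum>l<n. [:A $$ (l, j):])"
        using ij by (simp add: sum_subtractf)
      also have "(\<Sum>l<n. [:A $$ (l, j):]) = [:\<Sum>l<n. A $$ (l, j):]"
        by (induction n) auto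
      finally show ?thesis using True ij carr by (simp add: Q_def col)
    next
      case False
      have "(\<Sum>l<n. E $$ (i, l) * ?C $$ (l, j)) = (\<Sum>l<n. if l = i then ?C $$ (l, j) else 0)"
        using False ij by (intro sum.cong refl) (auto simp: E_def)
      then show ?thesis using False ij carr by (simp add: Q_def)
    qed
    finally show "(E * ?C) $$ (i, j) = multrow 0 [:- d, 1:] Q $$ (i, j)" .
  qed (use carr C in auto)
  have "upper_triangular E" by (auto simp: E_def)
  then have "det E = prod_list (diag_mat E)" using carr(1) by (rule det_upper_triangular)
  also have "\<dots> = 1" using carr by (auto simp: diag_mat_def E_def intro!: prod_list_neutral)
  finally have "char_poly A = det (E * ?C)"
    by (simp add: det_mult[OF carr(1) C] char_poly_def)
  also have "\<dots> = [:- d, 1:] * det Q" unfolding EC by (rule det_multrow[OF n carr(2)])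
  finally have fac: "char_poly A = [:- d, 1:] * det Q" .
  have "poly (det Q) M = det R"
    using carr by (intro poly_det_cong) (auto simp: Q_def R_def Cij)
  also have "\<dots> = 0"
  proof -
    have "R *\<^sub>v vec n y = 0\<^sub>v n"
    proof (rule eq_vecI)
      fix i assume "i < dim_vec (0\<^sub>v n :: real vec)"
      then have i: "i < n" by simp
      have "(R *\<^sub>v vec n y) $ i = (\<Sum>j<n. R $$ (i, j) * y j)"
        using i carr by (simp add: scalar_prod_def lessThan_atLeast0)
      also have "\<dots> = 0"
      proof (cases "i = 0")
        case True
        then show ?thesis using y0 i by (simp add: R_def)
      next
        case False
        have "(\<Sum>j<n. R $$ (i, j) * y j) = (\<Sum>j<n. (if j = i then M * y i else 0) - A $$ (i, j) * y j)"
          using i False by (intro sum.cong refl) (auto simp: R_def algebra_simps)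
        then show ?thesis using i by (simp add: sum_subtractf ev)
      qed
      finally show "(R *\<^sub>v vec n y) $ i = 0\<^sub>v n $ i" using i by simp
    qed (use carr in auto)
    moreover have "vec n y \<noteq> 0\<^sub>v n" using y1 by (metis index_vec index_zero_vec(1))
    ultimately show ?thesis using det_0_iff_vec_prod_zero_field[OF carr(3)] vec_carrier by blast
  qed
  finally have "poly (det Q) M = 0" .
  moreover have "char_poly A \<noteq> 0" using degree_monic_char_poly[OF A] by force
  then have "det Q \<noteq> 0" using fac by auto
  \<comment> \<open>As \<open>M\<close> is a root of the cofactor, \<open>d\<close> and
    \<open>M\<close> are counted separately even if they coincide.\<close>
  ultimately have "M \<in># proots (det Q)" by simp
  moreover have "proots (char_poly A) = {#d#} + proots (det Q)"
    unfolding fac using \<open>det Q \<noteq> 0\<close> by (subst proots_mult) auto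
  ultimately show ?thesis by simp
qed

text \<open>Maximizing the forms of \<open>A\<close> and of \<open>- A\<close> over sum-zero vectors
  gives eigenvalues \<open>M\<close> and \<open>- N\<close> of \<open>A\<close>, each occurring
  beside the eigenvalue \<open>d\<close> of the constant vector. Comparing them with the second and
  the last root bounds the form from both sides.\<close>

lemma expansion_bounds_quad_form:
  fixes A :: "real mat" and d :: real and n :: nat
  defines "L \<equiv> rev (sorted_list_of_multiset (proots (char_poly A)))"
  defines "lam \<equiv> max (L ! 1) (- L ! (n - 1))"
  assumes A: "A \<in> carrier_mat n n" and n: "0 < n"
    and sym: "\<And>i j. i < n \<Longrightarrow> j < n \<Longrightarrow> A $$ (i, j) = A $$ (j, i)"
    and diag: "\<And>i. i < n \<Longrightarrow> A $$ (i, i) = 0"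
    and row: "\<And>i. i < n \<Longrightarrow> (\<Sum>j<n. A $$ (i, j)) = d"
    and less: "lam < d"
  shows "0 \<le> lam"
    and "(\<Sum>i<n. x i) = 0 \<Longrightarrow>
      \<bar>quad_form {..<n} (\<lambda>i j. A $$ (i, j)) x\<bar> \<le> lam * (\<Sum>i<n. (x i)\<^sup>2)"
proof -
  let ?p = "char_poly A" and ?a = "\<lambda>i j. A $$ (i, j)"
  have size: "size (proots ?p) = n" by (rule size_proots_char_poly_symmetric[OF A sym])
  have col: "(\<Sum>i<n. A $$ (i, j)) = d" if "j < n" for j
  proof -
    have "(\<Sum>i<n. A $$ (i, j)) = (\<Sum>i<n. A $$ (j, i))"
      using that by (intro sum.cong refl) (auto intro: sym)
    then show ?thesis using row[OF that] by simp
  qed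
  \<comment> \<open>For \<open>n = 1\<close> the only root is 0, so \<open>lam \<ge> 0 = d\<close>
    whatever the unspecified \<open>L ! 1\<close> is.\<close>
  have "n \<noteq> 1"
  proof
    assume "n = 1"
    then have A1: "A \<in> carrier_mat 1 1" and "d = 0" using A row[of 0] diag[of 0] by auto
    have "?p = [:0, 1:]"
      using diag[of 0] A1 \<open>n = 1\<close> by (simp add: char_poly_defs det_single)
    then have "L ! 0 = 0" by (simp add: L_def)
    then show False using less \<open>d = 0\<close> \<open>n = 1\<close> by (simp add: lam_def)
  qed
  then have n2: "card {..<n} \<ge> 2" using n by simp
  have symB: "\<forall>i\<in>{..<n}. \<forall>j\<in>{..<n}. ?a i j = ?a j i" using sym by blast
  have rowB: "\<forall>i\<in>{..<n}. (\<Sum>j<n. ?a i j) = d" using row by blast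
  from rayleigh_maximizer_sum_zero[OF finite_lessThan n2 symB rowB]
  obtain y M where y: "(\<Sum>i<n. y i) = 0" "(\<Sum>i<n. (y i)\<^sup>2) = 1"
    "\<forall>i\<in>{..<n}. (\<Sum>j<n. ?a i j * y j) = M * y i"
    and M: "\<forall>x. (\<Sum>i<n. x i) = 0 \<longrightarrow> quad_form {..<n} ?a x \<le> M * (\<Sum>i<n. (x i)\<^sup>2)"
    by blast
  have symN: "\<forall>i\<in>{..<n}. \<forall>j\<in>{..<n}. - ?a i j = - ?a j i" using symB by simp
  have rowN: "\<forall>i\<in>{..<n}. (\<Sum>j<n. - ?a i j) = - d" using rowB by (simp add: sum_negf)
  from rayleigh_maximizer_sum_zero[OF finite_lessThan n2 symN rowN]
  obtain z N where z: "(\<Sum>i<n. z i) = 0" "(\<Sum>i<n. (z i)\<^sup>2) = 1"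
    "\<forall>i\<in>{..<n}. (\<Sum>j<n. - ?a i j * z j) = N * z i"
    and N: "\<forall>x. (\<Sum>i<n. x i) = 0 \<longrightarrow>
      quad_form {..<n} (\<lambda>i j. - ?a i j) x \<le> N * (\<Sum>i<n. (x i)\<^sup>2)"
    by blast
  have nz: "\<exists>k<n. w k \<noteq> 0" if "(\<Sum>i<n. (w i)\<^sup>2) = 1" for w :: "nat \<Rightarrow> real"
  proof (rule ccontr)
    assume "\<not> ?thesis"
    then have "(\<Sum>i<n. (w i)\<^sup>2) = 0" by (intro sum.neutral) auto
    then show False using that by simp
  qed
  from nz[OF y(2)] obtain k where "k < n" "y k \<noteq> 0" by blast
  then have sub: "{#d, M#} \<subseteq># proots ?p"
    using y(3) by (intro proots_char_poly_two_eigenvalues[OF A col y(1)]) auto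
  have "min d M \<le> L ! 1" unfolding L_def by (rule sorted_desc_first_two(1)[OF sub])
  moreover have "L ! 1 \<le> lam" by (simp add: lam_def)
  \<comment> \<open>If \<open>M \<ge> d\<close>, the second largest root would be at least
    \<open>d\<close>, against \<open>lam < d\<close>; so the minimum is \<open>M\<close>.\<close>
  ultimately have Mlam: "M \<le> lam" using less by (auto simp: min_def split: if_splits)
  from nz[OF z(2)] obtain l where "l < n" "z l \<noteq> 0" by blast
  moreover have "(\<Sum>j<n. A $$ (i, j) * z j) = - N * z i" if "i < n" for i
    using bspec[OF z(3), of i] that by (simp add: sum_negf)
  ultimately have "{#d, - N#} \<subseteq># proots ?p"
    by (intro proots_char_poly_two_eigenvalues[OF A col z(1)]) auto
  then have "- N \<in># proots ?p" by (auto dest: mset_subset_eqD)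
  then have "L ! (n - 1) \<le> - N"
    using sorted_desc_nth_le(2)[of "- N" "proots ?p"] by (simp add: L_def size)
  then have Nlam: "N \<le> lam" by (simp add: lam_def)
  have bound: "\<bar>quad_form {..<n} ?a x\<bar> \<le> lam * (\<Sum>i<n. (x i)\<^sup>2)" if "(\<Sum>i<n. x i) = 0" for x
  proof -
    have "(\<Sum>i<n. (x i)\<^sup>2) \<ge> 0" by (simp add: sum_nonneg)
    then have "M * (\<Sum>i<n. (x i)\<^sup>2) \<le> lam * (\<Sum>i<n. (x i)\<^sup>2)"
      "N * (\<Sum>i<n. (x i)\<^sup>2) \<le> lam * (\<Sum>i<n. (x i)\<^sup>2)"
      using Mlam Nlam by (auto intro: mult_right_mono)
    then show ?thesis using M[rule_format, OF that] N[rule_format, OF that] by (simp add: quad_form_uminus)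
  qed
  then show "(\<Sum>i<n. x i) = 0 \<Longrightarrow> \<bar>quad_form {..<n} ?a x\<bar> \<le> lam * (\<Sum>i<n. (x i)\<^sup>2)" .
  show "0 \<le> lam" using bound[OF y(1)] y(2) by simp
qed

section \<open>The expander mixing lemma\<close>

lemma quad_form_reindex:
  assumes "bij_betw g I V"
  shows "quad_form I (\<lambda>i j. a (g i) (g j)) (\<lambda>i. x (g i)) = quad_form V a x"
proof -
  have "(\<Sum>j\<in>I. a u (g j) * x u * x (g j)) = (\<Sum>v\<in>V. a u v * x u * x v)" for u
    by (rule sum.reindex_bij_betw[OF assms, of "\<lambda>v. a u v * x u * x v"])
  then show ?thesis
    using sum.reindex_bij_betw[OF assms, of "\<lambda>u. \<Sum>v\<in>V. a u v * x u * x v"]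
    by (simp add: quad_form_def)
qed

text \<open>For an adjacency kernel the first term counts the arcs inside \<open>U\<close>. The
  other two terms depend only on the row sums, since the constant function is an
  eigenvector.\<close>

lemma quad_form_indicator:
  fixes a :: "'a \<Rightarrow> 'a \<Rightarrow> real"
  assumes fin: "finite V" and U: "U \<subseteq> V"
    and sym: "\<And>u v. u \<in> V \<Longrightarrow> v \<in> V \<Longrightarrow> a u v = a v u"
    and row: "\<And>u. u \<in> V \<Longrightarrow> (\<Sum>v\<in>V. a u v) = d"
  shows "quad_form V a (\<lambda>v. of_bool (v \<in> U) + t * 1) =
    (\<Sum>u\<in>U. \<Sum>v\<in>U. a u v) + 2 * t * (d * card U) + t\<^sup>2 * (d * card V)"
proof -
  have V: "V \<inter> U = U" using U by blast
  have *: "(\<Sum>j\<in>V. g j * of_bool (j \<in> U)) = (\<Sum>j\<in>U. g j)" for g :: "'a \<Rightarrow> real"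
    using fin by (simp add: of_bool_def if_distrib[of "\<lambda>z. _ * z"] sum.If_cases V cong: if_cong)
  have "quad_form V a (\<lambda>v. of_bool (v \<in> U)) = (\<Sum>u\<in>V. (\<Sum>v\<in>U. a u v) * of_bool (u \<in> U))"
    unfolding quad_form_def
    by (intro sum.cong refl) (simp add: *[symmetric] sum_distrib_right algebra_simps)
  also have "\<dots> = (\<Sum>u\<in>U. \<Sum>v\<in>U. a u v)" by (rule *)
  finally have 1: "quad_form V a (\<lambda>v. of_bool (v \<in> U)) = (\<Sum>u\<in>U. \<Sum>v\<in>U. a u v)" .
  have "(\<Sum>i\<in>V. (\<Sum>j\<in>V. a i j * of_bool (j \<in> U)) * 1) = (\<Sum>i\<in>V. \<Sum>j\<in>U. a i j)"
    by (simp add: *)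
  also have "\<dots> = (\<Sum>j\<in>U. \<Sum>i\<in>V. a i j)" by (rule sum.swap)
  also have "\<dots> = (\<Sum>j\<in>U. d)"
  proof (rule sum.cong[OF refl])
    fix j assume "j \<in> U"
    then have "(\<Sum>i\<in>V. a i j) = (\<Sum>i\<in>V. a j i)" using U sym by (intro sum.cong refl) auto
    then show "(\<Sum>i\<in>V. a i j) = d" using row U \<open>j \<in> U\<close> by auto
  qed
  finally have 2: "(\<Sum>i\<in>V. (\<Sum>j\<in>V. a i j * of_bool (j \<in> U)) * 1) = d * card U" by simp
  have 3: "quad_form V a (\<lambda>_. 1) = d * card V" using row by (simp add: quad_form_def)
  have "quad_form V a (\<lambda>v. of_bool (v \<in> U) + t * 1) = quad_form V a (\<lambda>v. of_bool (v \<in> U))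
      + 2 * t * (\<Sum>i\<in>V. (\<Sum>j\<in>V. a i j * of_bool (j \<in> U)) * 1) + t\<^sup>2 * quad_form V a (\<lambda>_. 1)"
    by (intro quad_form_add_scaled sym)
  then show ?thesis unfolding 1 2 3 .
qed

text \<open>The spectral bound is applied to the indicator of \<open>U\<close> minus its mean;
  multiplying by the number of vertices clears denominators.\<close>

lemma expander_mixing:
  fixes a :: "'a \<Rightarrow> 'a \<Rightarrow> real" and d lam :: real
  assumes fin: "finite V" and ne: "V \<noteq> {}" and U: "U \<subseteq> V"
    and sym: "\<And>u v. u \<in> V \<Longrightarrow> v \<in> V \<Longrightarrow> a u v = a v u"
    and row: "\<And>u. u \<in> V \<Longrightarrow> (\<Sum>v\<in>V. a u v) = d"
    and gap: "\<And>x. (\<Sum>v\<in>V. x v) = 0 \<Longrightarrow> \<bar>quad_form V a x\<bar> \<le> lam * (\<Sum>v\<in>V. (x v)\<^sup>2)"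
  shows "\<bar>card V * (\<Sum>u\<in>U. \<Sum>v\<in>U. a u v) - d * (card U)\<^sup>2\<bar>
    \<le> lam * (card U * (real (card V) - card U))"
proof -
  define n u e where "n = real (card V)" and "u = real (card U)" and "e = (\<Sum>u\<in>U. \<Sum>v\<in>U. a u v)"
  have n: "n > 0" using fin ne by (simp add: n_def card_gt_0_iff)
  \<comment> \<open>Minus the density of \<open>U\<close>, the shift that makes the test function
    sum to zero.\<close>
  define t where "t = - u / n"
  have tn: "t * n = - u" using n by (simp add: t_def)
  let ?x = "\<lambda>v. of_bool (v \<in> U) + t * 1 :: real"
  have V: "V \<inter> U = U" using U by blast
  have ind: "(\<Sum>v\<in>V. of_bool (v \<in> U)) = u"
    using fin by (simp add: V u_def)
  have "(\<Sum>v\<in>V. ?x v) = u + t * n"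
    by (simp add: sum.distrib ind n_def)
  then have "(\<Sum>v\<in>V. ?x v) = 0" by (simp add: tn)
  from gap[OF this]
  have "\<bar>quad_form V a ?x\<bar> \<le> lam * (\<Sum>v\<in>V. (?x v)\<^sup>2)" .
  moreover have "quad_form V a ?x = e + 2 * t * (d * u) + t\<^sup>2 * (d * n)"
    unfolding e_def u_def n_def by (rule quad_form_indicator[OF fin U sym row])
  moreover have "(\<Sum>v\<in>V. (?x v)\<^sup>2) = (\<Sum>v\<in>V. of_bool (v \<in> U) * (1 + 2 * t) + t\<^sup>2)"
    by (intro sum.cong refl) (auto simp: power2_eq_square algebra_simps)
  then have "(\<Sum>v\<in>V. (?x v)\<^sup>2) = u * (1 + 2 * t) + n * t\<^sup>2"
    by (simp add: sum.distrib sum_distrib_right[symmetric] ind n_def)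
  ultimately have "n * \<bar>e + 2 * t * (d * u) + t\<^sup>2 * (d * n)\<bar> \<le> n * (lam * (u * (1 + 2 * t) + n * t\<^sup>2))"
    using n by simp
  moreover have "n * \<bar>e + 2 * t * (d * u) + t\<^sup>2 * (d * n)\<bar> = \<bar>n * (e + 2 * t * (d * u) + t\<^sup>2 * (d * n))\<bar>"
    using n by (simp add: abs_mult)
  moreover have "n * (e + 2 * t * (d * u) + t\<^sup>2 * (d * n)) = n * e + 2 * (t * n) * d * u + (t * n)\<^sup>2 * d"
    by (simp add: power2_eq_square algebra_simps)
  moreover have "n * (lam * (u * (1 + 2 * t) + n * t\<^sup>2)) = lam * (u * (n + 2 * (t * n)) + (t * n)\<^sup>2)"
    by (simp add: power2_eq_square algebra_simps)
  ultimately have "\<bar>n * e + 2 * (- u) * d * u + (- u)\<^sup>2 * d\<bar> \<le> lam * (u * (n + 2 * (- u)) + (- u)\<^sup>2)"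
    unfolding tn by simp
  then have "\<bar>n * e - d * u\<^sup>2\<bar> \<le> lam * (u * (n - u))"
    by (simp add: power2_eq_square algebra_simps)
  then show ?thesis by (simp add: n_def u_def e_def)
qed

section \<open>Components and nodal domains\<close>

text \<open>For symmetric \<open>E\<close> and \<open>v\<close> in \<open>U\<close> this is the
  vertex set of a connected component of the subgraph induced on \<open>U\<close>. Reflexivity puts
  \<open>v\<close> in it even if \<open>v\<close> lies outside \<open>U\<close>.\<close>

definition component :: "'a rel \<Rightarrow> 'a set \<Rightarrow> 'a \<Rightarrow> 'a set" where
  "component E U v = (E \<inter> U \<times> U)\<^sup>* `` {v}"

lemma component_self: "v \<in> component E U v"
  by (simp add: component_def)

lemma component_subset: "v \<in> U \<Longrightarrow> component E U v \<subseteq> U"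
proof
  fix w assume "v \<in> U" "w \<in> component E U v"
  then have "(v, w) \<in> (E \<inter> U \<times> U)\<^sup>*" by (simp add: component_def)
  then show "w \<in> U" using \<open>v \<in> U\<close> by (induction) auto
qed

lemma component_step:
  assumes "u \<in> component E U v" "v \<in> U" "(u, w) \<in> E" "w \<in> U"
  shows "w \<in> component E U v"
proof -
  have "u \<in> U" using component_subset[OF assms(2), of E] assms(1) by blast
  then have "(u, w) \<in> E \<inter> U \<times> U" using assms by simp
  with assms(1) show ?thesis by (simp add: component_def rtrancl_into_rtrancl)
qed

text \<open>No arc joins two components, so \<open>e\<close> is additive over them. Each component's
  upper bound is made linear in its size, so the bounds add up to a multiple of
  \<open>card U\<close>, which then cancels.\<close>

lemma large_component:
  fixes E :: "'a rel" and d lam :: real and e :: "'a set \<Rightarrow> real"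
  defines "e \<equiv> \<lambda>U. \<Sum>u\<in>U. \<Sum>v\<in>U. of_bool ((u, v) \<in> E)"
  assumes fin: "finite V" and U: "U \<subseteq> V" "U \<noteq> {}" and "sym E" and less: "lam < d"
    and mixing: "\<And>U. U \<subseteq> V \<Longrightarrow>
      \<bar>card V * e U - d * (card U)\<^sup>2\<bar> \<le> lam * (card U * (real (card V) - card U))"
  obtains v where "v \<in> U"
    "(d + lam) * card U - 2 * lam * card V \<le> (d - lam) * card (component E U v)"
proof -
  let ?K = "component E U"
  have finU: "finite U" using fin U(1) finite_subset by blast
  define m where "m = Max ((\<lambda>v. card (?K v)) ` U)"
  have m_in: "m \<in> (\<lambda>v. card (?K v)) ` U"
    unfolding m_def using finU U(2) by (intro Max_in) auto
  have m_max: "card (?K v) \<le> m" if "v \<in> U" for v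
    unfolding m_def using finU that by (intro Max_ge) auto
  \<comment> \<open>Restricted to \<open>U\<close>, reachability is an equivalence relation whose
    classes are the components, so sums over \<open>U\<close> split along the quotient.\<close>
  define r where "r = {(x, y) \<in> U \<times> U. (x, y) \<in> (E \<inter> U \<times> U)\<^sup>*}"
  have "sym (E \<inter> U \<times> U)" using \<open>sym E\<close> by (auto simp: sym_def)
  then have "sym ((E \<inter> U \<times> U)\<^sup>*)" by (rule sym_rtrancl)
  then have "sym r" by (auto simp: r_def sym_def)
  moreover have "trans r"
  proof (rule transI)
    fix x y z assume "(x, y) \<in> r" "(y, z) \<in> r"
    then show "(x, z) \<in> r" using rtrancl_trans[of x y _ z] by (simp add: r_def)
  qed
  moreover have rU: "r \<subseteq> U \<times> U" and "refl_on U r" by (auto simp: r_def refl_on_def)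
  ultimately have eq: "equiv U r" by (simp add: equiv_def)
  have quot: "\<exists>v\<in>U. C = ?K v" if C: "C \<in> U // r" for C
  proof -
    obtain v where v: "v \<in> U" "C = r `` {v}" using C unfolding quotient_def by blast
    have "C = ?K v" using component_subset[OF v(1), of E] v by (auto simp: r_def component_def)
    then show ?thesis using v(1) by blast
  qed
  have split: "(\<Sum>u\<in>U. g u) = (\<Sum>C\<in>U // r. \<Sum>u\<in>C. g u)" for g :: "'a \<Rightarrow> real"
  proof -
    have "sum g (\<Union> (U // r)) = (sum \<circ> sum) g (U // r)"
    proof (rule sum.Union_disjoint)
      show "\<forall>C\<in>U // r. finite C" using finite_equiv_class[OF finU rU] by blast
      show "\<forall>C\<in>U // r. \<forall>D\<in>U // r. C \<noteq> D \<longrightarrow> C \<inter> D = {}" using quotient_disj[OF eq] by blast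
    qed
    then show ?thesis by (simp add: Union_quotient[OF eq])
  qed
  have "e U = (\<Sum>C\<in>U // r. \<Sum>u\<in>C. \<Sum>w\<in>U. of_bool ((u, w) \<in> E))"
    unfolding e_def by (rule split)
  also have "\<dots> = (\<Sum>C\<in>U // r. e C)"
    unfolding e_def
  proof (rule sum.cong[OF refl], rule sum.cong[OF refl])
    fix C u assume "C \<in> U // r" and u: "u \<in> C"
    then obtain v where v: "v \<in> U" "C = ?K v" using quot by blast
    show "(\<Sum>w\<in>U. of_bool ((u, w) \<in> E)) = (\<Sum>w\<in>C. of_bool ((u, w) \<in> E) :: real)"
      using finU component_subset[OF v(1), of E] component_step[of u E U v] u v
      by (intro sum.mono_neutral_right) auto
  qed
  finally have "card V * e U = (\<Sum>C\<in>U // r. card V * e C)" by (simp add: sum_distrib_left)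
  also have "\<dots> \<le> (\<Sum>C\<in>U // r. card C * ((d - lam) * m + lam * card V))"
  proof (rule sum_mono)
    fix C assume "C \<in> U // r"
    then obtain v where v: "v \<in> U" "C = ?K v" using quot by blast
    then have "C \<subseteq> V" using component_subset[OF v(1), of E] U(1) by simp
    then have "card V * e C \<le> d * (card C)\<^sup>2 + lam * (card C * (real (card V) - card C))"
      using mixing[of C] by linarith
    also have "\<dots> = card C * ((d - lam) * card C + lam * card V)"
      by (simp add: power2_eq_square algebra_simps)
    \<comment> \<open>Only one of the two factors \<open>card C\<close> is replaced by
      \<open>m\<close>; \<open>lam < d\<close> gives the direction.\<close>
    also have "\<dots> \<le> card C * ((d - lam) * m + lam * card V)"
      using m_max[OF v(1)] v(2) less by (intro mult_left_mono add_right_mono) auto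
    finally show "card V * e C \<le> card C * ((d - lam) * m + lam * card V)" .
  qed
  also have "\<dots> = (\<Sum>C\<in>U // r. real (card C)) * ((d - lam) * m + lam * card V)"
    by (simp only: sum_distrib_right)
  also have "(\<Sum>C\<in>U // r. real (card C)) = card U" using split[of "\<lambda>_. 1"] by simp
  finally have upper: "card V * e U \<le> card U * ((d - lam) * m + lam * card V)" .
  have "card U * (d * card U - lam * (real (card V) - card U)) \<le> card V * e U"
    using mixing[OF U(1)] by (simp add: power2_eq_square algebra_simps)
  with upper have "card U * (d * card U - lam * (real (card V) - card U))
      \<le> card U * ((d - lam) * m + lam * card V)" by linarith
  moreover have "real (card U) > 0" using finU U(2) by (simp add: card_gt_0_iff)
  ultimately have "d * card U - lam * (real (card V) - card U) \<le> (d - lam) * m + lam * card V"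
    by (simp only: mult_le_cancel_left_pos)
  then have "(d + lam) * card U - 2 * lam * card V \<le> (d - lam) * m"
    by (simp add: algebra_simps)
  with m_in that show ?thesis by blast
qed

text \<open>The spectral gap forces connectedness: all \<open>d * card C\<close> arcs that leave
  vertices of a closed set stay inside it, so the mixing bound becomes
  \<open>(d - lam) * (card C * (card V - card C)) \<le> 0\<close>.\<close>

lemma mixing_closed_set:
  fixes E :: "'a rel" and d lam :: real
  assumes fin: "finite V" and C: "C \<subseteq> V" "C \<noteq> {}" and less: "lam < d"
    and row: "\<And>u. u \<in> V \<Longrightarrow> (\<Sum>v\<in>V. of_bool ((u, v) \<in> E)) = d"
    and mixing: "\<bar>card V * (\<Sum>u\<in>C. \<Sum>v\<in>C. of_bool ((u, v) \<in> E) :: real) - d * (card C)\<^sup>2\<bar>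
      \<le> lam * (card C * (real (card V) - card C))"
    and closed: "\<And>u v. u \<in> C \<Longrightarrow> v \<in> V \<Longrightarrow> (u, v) \<in> E \<Longrightarrow> v \<in> C"
  shows "C = V"
proof -
  have "(\<Sum>v\<in>C. of_bool ((u, v) \<in> E)) = d" if "u \<in> C" for u
  proof -
    have "(\<Sum>v\<in>V. of_bool ((u, v) \<in> E)) = (\<Sum>v\<in>C. of_bool ((u, v) \<in> E) :: real)"
      using fin C(1) closed[OF that] by (intro sum.mono_neutral_right) auto
    then show ?thesis using row C(1) that by auto
  qed
  then have "(\<Sum>u\<in>C. \<Sum>v\<in>C. of_bool ((u, v) \<in> E)) = card C * d" by simp
  then have "(d - lam) * (card C * (real (card V) - card C)) \<le> 0"
    using mixing by (simp add: power2_eq_square algebra_simps)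
  moreover have "real (card C) > 0"
    using C finite_subset[OF C(1) fin] by (simp add: card_gt_0_iff)
  ultimately have "card V \<le> card C" using less by (simp add: mult_le_0_iff)
  then show ?thesis using fin C(1) by (simp add: card_seteq)
qed

section \<open>Sizes of nodal domains, and components as nodal domains\<close>

text \<open>Since \<open>mset_set\<close> sends infinite sets to the empty multiset, finiteness is
  what makes \<open>nodal_domain_size\<close> meaningful. Subgraphs inherit \<open>tail\<close> and
  \<open>head\<close>, so only the vertex and arc sets vary.\<close>

lemma finite_nodal_domains:
  assumes "pair_fin_digraph G"
  shows "finite (nodal_domains G f)"
proof -
  interpret pair_fin_digraph G by fact
  let ?mk = "\<lambda>(A, B). \<lparr>verts = A, arcs = B, tail = fst, head = snd\<rparr>"
  have "nodal_domains G f \<subseteq> ?mk ` (Pow (pverts G) \<times> Pow (parcs G))"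
  proof
    fix S assume "S \<in> nodal_domains G f"
    then have "subgraph S (with_proj G)" by (simp add: nodal_domains_def max_subgraph_def)
    then have "verts S \<subseteq> pverts G" "arcs S \<subseteq> parcs G" "tail S = fst" "head S = snd"
      by (auto simp: subgraph_def compatible_def)
    then show "S \<in> ?mk ` (Pow (pverts G) \<times> Pow (parcs G))"
      by (intro image_eqI[of _ _ "(verts S, arcs S)"]) auto
  qed
  then show ?thesis
    using pair_finite_verts pair_finite_arcs by (auto intro: finite_subset)
qed

lemma nodal_domain_size_ge:
  assumes "pair_fin_digraph G"
  shows "S \<in> nodal_domains G f \<Longrightarrow> card (verts S) \<le> nodal_domain_size G f 1"
    and "S \<in> nodal_domains G f \<Longrightarrow> T \<in> nodal_domains G f \<Longrightarrow> S \<noteq> T \<Longrightarrow>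
      card (verts S) + card (verts T) \<le> nodal_domain_size G f 1 + nodal_domain_size G f 2"
proof -
  let ?M = "image_mset (\<lambda>S. card (verts S)) (mset_set (nodal_domains G f))"
  let ?L = "rev (sorted_list_of_multiset ?M)"
  have fin: "finite (nodal_domains G f)" by (rule finite_nodal_domains[OF assms])
  have len: "length ?L = size ?M"
    by (metis length_rev mset_sorted_list_of_multiset size_mset)
  have sz: "nodal_domain_size G f k = (if k \<le> size ?M then ?L ! (k - 1) else 0)" for k
    unfolding nodal_domain_size_def Let_def len ..
  {
    assume S: "S \<in> nodal_domains G f"
    then have in_M: "card (verts S) \<in># ?M" using fin by auto
    then have "1 \<le> size ?M" by (metis One_nat_def Suc_leI nonempty_has_size empty_iff set_mset_empty)
    then show "card (verts S) \<le> nodal_domain_size G f 1"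
      using sorted_desc_nth_le(1)[OF in_M] sz[of 1] by simp
  }
  assume S: "S \<in> nodal_domains G f" and T: "T \<in> nodal_domains G f" and ne: "S \<noteq> T"
  have "mset_set {S, T} \<subseteq># mset_set (nodal_domains G f)"
    using S T fin by (intro subset_imp_msubset_mset_set) auto
  then have "image_mset (\<lambda>S. card (verts S)) (mset_set {S, T}) \<subseteq># ?M" by (rule image_mset_subseteq_mono)
  then have sub: "{#card (verts S), card (verts T)#} \<subseteq># ?M" using ne by simp
  \<comment> \<open>The sum of two sizes is their maximum plus their minimum, bounded by the first
    and the second entry.\<close>
  show "card (verts S) + card (verts T) \<le> nodal_domain_size G f 1 + nodal_domain_size G f 2"
    using sorted_desc_first_two[OF sub] sz[of 1] sz[of 2]
    by (simp add: min_def max_def split: if_splits)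
qed

text \<open>Both signs enter the definition alike; this reduces the nonpositive set of
  \<open>f\<close> to the nonnegative set of \<open>- f\<close>.\<close>

lemma nodal_domains_uminus: "nodal_domains G (\<lambda>v. - f v) = nodal_domains G f"
  unfolding nodal_domains_def by (simp add: disj_commute)

context pair_graph
begin

lemma connected_component:
  assumes U: "U \<subseteq> pverts G" and v: "v \<in> U"
  defines "C \<equiv> component (parcs G) U v"
  shows "Digraph_Component.connected (with_proj \<lparr>pverts = C, parcs = parcs G \<inter> C \<times> C\<rparr>)"
proof -
  let ?R = "parcs G \<inter> U \<times> U" and ?H = "\<lparr>pverts = C, parcs = parcs G \<inter> C \<times> C\<rparr>"
  have "sym ?R" unfolding sym_def using arcs_symmetric by blast
  then have "sym (?R\<^sup>*)" by (rule sym_rtrancl)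
  have "x \<rightarrow>\<^sup>*\<^bsub>with_proj (mk_symmetric (with_proj ?H))\<^esub> y" if x: "x \<in> C" and y: "y \<in> C" for x y
  proof -
    have "(v, x) \<in> ?R\<^sup>*" "(v, y) \<in> ?R\<^sup>*" using x y by (simp_all add: C_def component_def)
    then have "(x, y) \<in> ?R\<^sup>*" using \<open>sym (?R\<^sup>*)\<close> by (meson rtrancl_trans symD)
    \<comment> \<open>The induction carries membership in \<open>C\<close> along, so that each arc
      of the path lies in the induced subgraph.\<close>
    then have "(x, y) \<in> rtrancl_on C (parcs (mk_symmetric (with_proj ?H))) \<and> y \<in> C"
    proof (induction rule: rtrancl_induct)
      case base
      show ?case using x by simp
    next
      case (step y z)
      then have "z \<in> C" using component_step[OF _ v, of y "parcs G" z] by (simp add: C_def)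
      moreover have "(y, z) \<in> parcs (mk_symmetric (with_proj ?H))"
        unfolding parcs_mk_symmetric using step \<open>z \<in> C\<close> by (intro UN_I[of "(y, z)"]) simp_all
      ultimately show ?case using step.IH by (meson rtrancl_on_into_rtrancl_on)
    qed
    then show ?thesis by (simp add: reachable_def)
  qed
  moreover have "C \<noteq> {}" using component_self by (force simp: C_def)
  ultimately show ?thesis by (simp add: connected_def strongly_connected_def)
qed

text \<open>Supplies maximality: a connected subgraph inside \<open>U\<close> that meets a component
  cannot leave it.\<close>

lemma connected_subset_component:
  assumes conn: "Digraph_Component.connected H" and sub: "subgraph H (with_proj G)"
    and HU: "verts H \<subseteq> U" and v: "v \<in> U" and w: "w \<in> verts H" "w \<in> component (parcs G) U v"
  shows "verts H \<subseteq> component (parcs G) U v"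
proof
  fix y assume "y \<in> verts H"
  then have "(w, y) \<in> rtrancl_on (verts H) (parcs (mk_symmetric H))"
    using conn w(1) by (simp add: connected_def strongly_connected_def reachable_def)
  then show "y \<in> component (parcs G) U v"
  proof (induction rule: rtrancl_on_induct)
    case base
    show ?case by fact
  next
    case (step y z)
    have ends: "tail H = fst" "head H = snd"
      using sub by (simp_all add: subgraph_def compatible_def)
    \<comment> \<open>Connectedness is tested in the symmetrization, which may reverse an arc of
      \<open>H\<close>; symmetry of \<open>G\<close> repairs this.\<close>
    have "(y, z) \<in> arcs H \<or> (z, y) \<in> arcs H"
      using step.hyps(2) by (auto simp: parcs_mk_symmetric ends)
    moreover have "arcs H \<subseteq> parcs G" using sub by (simp add: subgraph_def)
    ultimately have "(y, z) \<in> parcs G" using arcs_symmetric by blast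
    moreover have "z \<in> U" using step.hyps(4) HU by blast
    ultimately show ?case by (rule component_step[OF step.IH v])
  qed
qed

text \<open>The positive value at \<open>w\<close> fixes the sign of every competing subgraph that
  contains \<open>C\<close>, so the competitor stays inside \<open>P\<close> and hence inside the
  component.\<close>

lemma nonneg_component_is_nodal_domain:
  fixes f :: "'a \<Rightarrow> real"
  defines "P \<equiv> {u \<in> pverts G. 0 \<le> f u}"
  assumes v: "v \<in> P" and w: "w \<in> component (parcs G) P v" "0 < f w"
  defines "C \<equiv> component (parcs G) P v"
  shows "with_proj \<lparr>pverts = C, parcs = parcs G \<inter> C \<times> C\<rparr> \<in> nodal_domains G f"
proof -
  let ?H = "with_proj \<lparr>pverts = C, parcs = parcs G \<inter> C \<times> C\<rparr>"
  have CP: "C \<subseteq> P" unfolding C_def by (rule component_subset[OF v])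
  have PV: "P \<subseteq> pverts G" by (auto simp: P_def)
  have wfH: "wf_digraph ?H" by unfold_locales auto
  have "subgraph ?H (with_proj G)"
    using CP PV wfH by (intro subgraphI) (auto intro: wf_digraph_axioms)
  moreover have "Digraph_Component.connected ?H"
    unfolding C_def by (rule connected_component[OF PV v])
  moreover have "\<forall>u\<in>verts ?H. 0 \<le> f u" using CP by (auto simp: P_def)
  moreover have "H' = ?H"
    if sub: "subgraph ?H H'" "subgraph H' (with_proj G)" and conn: "Digraph_Component.connected H'"
      and sign: "(\<forall>u\<in>verts H'. 0 \<le> f u) \<or> (\<forall>u\<in>verts H'. f u \<le> 0)" for H'
  proof -
    have CH: "C \<subseteq> verts H'" using sub(1) by (simp add: subgraph_def)
    then have wH: "w \<in> verts H'" using w(1) by (auto simp: C_def)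
    then have "\<forall>u\<in>verts H'. 0 \<le> f u" using sign w(2) by force
    then have "verts H' \<subseteq> P" using sub(2) by (auto simp: P_def subgraph_def)
    then have HC: "verts H' = C"
      using connected_subset_component[OF conn sub(2) _ v wH w(1)] CH by (simp add: C_def)
    have ends: "tail H' = fst" "head H' = snd"
      using sub(2) by (auto simp: subgraph_def compatible_def)
    have "arcs H' \<subseteq> parcs G" using sub(2) by (simp add: subgraph_def)
    \<comment> \<open>Maximality compares whole graphs, so the arc sets must agree too;
      well-formedness keeps the ends of arcs in \<open>C\<close>.\<close>
    moreover have "fst e \<in> C" "snd e \<in> C" if "e \<in> arcs H'" for e
      using wf_digraph.wellformed[of H' e] sub(2) that ends HC by (auto simp: subgraph_def)
    ultimately have "arcs H' \<subseteq> parcs G \<inter> C \<times> C" by (auto simp: mem_Times_iff)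
    moreover have "parcs G \<inter> C \<times> C \<subseteq> arcs H'" using sub(1) by (simp add: subgraph_def)
    ultimately have "arcs H' = arcs ?H" by auto
    then show ?thesis using HC ends by (intro pre_digraph.equality) auto
  qed
  ultimately show ?thesis
    unfolding nodal_domains_def max_subgraph_def by blast
qed

end

text \<open>If \<open>f\<close> vanished on the whole component, the eigenvalue equation would exclude negative neighbours
  as well, so the component would be closed under adjacency and \<open>f\<close> would be zero.\<close>
lemma nonneg_component_has_positive:
  fixes E :: "'a rel" and f :: "'a \<Rightarrow> real" and mu :: real
  assumes fin: "finite V" and v: "v \<in> V" "0 \<le> f v"
    and eig: "\<And>u. u \<in> V \<Longrightarrow> (\<Sum>w\<in>V. of_bool ((u, w) \<in> E) * f w) = mu * f u"
    and nonzero: "\<exists>u\<in>V. f u \<noteq> 0"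
    and closed: "\<And>C. C \<subseteq> V \<Longrightarrow> C \<noteq> {} \<Longrightarrow>
      (\<And>u w. u \<in> C \<Longrightarrow> w \<in> V \<Longrightarrow> (u, w) \<in> E \<Longrightarrow> w \<in> C) \<Longrightarrow> C = V"
  shows "\<exists>w\<in>component E {u \<in> V. 0 \<le> f u} v. 0 < f w"
proof (rule ccontr)
  let ?P = "{u \<in> V. 0 \<le> f u}"
  let ?C = "component E ?P v"
  assume neg: "\<not> ?thesis"
  have vP: "v \<in> ?P" using v by simp
  have CP: "?C \<subseteq> ?P" by (rule component_subset[OF vP])
  have zero: "f u = 0" if "u \<in> ?C" for u
    using CP neg that by force
  have step: "w \<in> ?C" if u: "u \<in> ?C" and w: "w \<in> V" and E: "(u, w) \<in> E" for u w
  proof -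
    \<comment> \<open>Neighbours of \<open>u\<close> with nonnegative value belong to the component,
      where \<open>f\<close> is zero. So the eigenvalue equation at \<open>u\<close> is a vanishing
      sum of nonpositive terms.\<close>
    have nonpos: "of_bool ((u, x) \<in> E) * f x \<le> 0" if x: "x \<in> V" for x
    proof (cases "(u, x) \<in> E \<and> 0 \<le> f x")
      case True
      then have "x \<in> ?C" using component_step[OF u vP] x by simp
      then show ?thesis using zero by simp
    qed auto
    have "(\<Sum>x\<in>V. of_bool ((u, x) \<in> E) * f x) = 0"
      using eig[of u] zero[OF u] CP u by auto
    then have "of_bool ((u, w) \<in> E) * f w = 0"
      using sum_nonneg_eq_0_iff[OF fin, of "\<lambda>x. - (of_bool ((u, x) \<in> E) * f x)"] nonpos w
      by (simp add: sum_negf)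
    then have "w \<in> ?P" using E w by simp
    then show ?thesis by (rule component_step[OF u vP E])
  qed
  have "?C = V"
    using CP component_self[of v E ?P] step by (intro closed) blast+
  then show False using nonzero zero by blast
qed

section \<open>Large nodal domains of an eigenvector and the final estimate\<close>

text \<open>The largest component of the nonnegative set is a nodal domain because \<open>f\<close>
  is positive somewhere on it. The conclusion keeps that positive vertex to tell this domain from
  one on which the function is nonpositive.\<close>

lemma (in pair_graph) large_nonneg_nodal_domain:
  fixes f :: "'a \<Rightarrow> real" and d lam mu :: real
  defines "P \<equiv> {u \<in> pverts G. 0 \<le> f u}"
  assumes ne: "P \<noteq> {}" and less: "lam < d"
    and row: "\<And>u. u \<in> pverts G \<Longrightarrow> (\<Sum>v\<in>pverts G. of_bool ((u, v) \<in> parcs G)) = d"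
    and mixing: "\<And>U. U \<subseteq> pverts G \<Longrightarrow>
      \<bar>real (card (pverts G)) * (\<Sum>u\<in>U. \<Sum>v\<in>U. of_bool ((u, v) \<in> parcs G)) - d * (card U)\<^sup>2\<bar>
      \<le> lam * (real (card U) * (real (card (pverts G)) - card U))"
    and eig: "\<And>u. u \<in> pverts G \<Longrightarrow>
      (\<Sum>w\<in>pverts G. of_bool ((u, w) \<in> parcs G) * f w) = mu * f u"
    and nonzero: "\<exists>u\<in>pverts G. f u \<noteq> 0"
  shows "\<exists>S\<in>nodal_domains G f. (\<forall>u\<in>verts S. 0 \<le> f u) \<and> (\<exists>w\<in>verts S. 0 < f w) \<and>
    (d + lam) * card P - 2 * lam * card (pverts G) \<le> (d - lam) * card (verts S)"
proof -
  have PV: "P \<subseteq> pverts G" by (auto simp: P_def)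
  have "sym (parcs G)" unfolding sym_def using arcs_symmetric by blast
  then obtain v where v: "v \<in> P"
    "(d + lam) * card P - 2 * lam * card (pverts G) \<le> (d - lam) * card (component (parcs G) P v)"
    using large_component[OF pair_finite_verts PV ne _ less mixing] by blast
  let ?C = "component (parcs G) P v"
  have closed: "C = pverts G" if "C \<subseteq> pverts G" "C \<noteq> {}"
    "\<And>u w. u \<in> C \<Longrightarrow> w \<in> pverts G \<Longrightarrow> (u, w) \<in> parcs G \<Longrightarrow> w \<in> C" for C
    by (rule mixing_closed_set[OF pair_finite_verts that(1,2) less row mixing[OF that(1)] that(3)])
  have "\<exists>w\<in>?C. 0 < f w"
    unfolding P_def using v(1) eig nonzero closed
    by (intro nonneg_component_has_positive[OF pair_finite_verts]) (auto simp: P_def)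
  then obtain w where w: "w \<in> ?C" "0 < f w" by blast
  let ?S = "with_proj \<lparr>pverts = ?C, parcs = parcs G \<inter> ?C \<times> ?C\<rparr>"
  have "?S \<in> nodal_domains G f"
    using nonneg_component_is_nodal_domain[of v f w] v(1) w unfolding P_def by blast
  moreover have "\<forall>u\<in>verts ?S. 0 \<le> f u" using component_subset[OF v(1)] by (auto simp: P_def)
  moreover have "\<exists>w\<in>verts ?S. 0 < f w" using w by auto
  moreover have "(d + lam) * card P - 2 * lam * card (pverts G) \<le> (d - lam) * card (verts ?S)"
    using v(2) by simp
  ultimately show ?thesis by blast
qed

theorem theorem7p2:
  fixes G :: "'a pair_pre_digraph" and vs :: "'a list" and f :: "'a \<Rightarrow> real" and n d :: nat
  assumes "pair_graph G"
    and "card (pverts G) = n"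
    and "regular_graph G d"
    and "vertex_enum G vs"
    and "spectral_expansion G vs < real d"
    and "adj_eigenvector G vs f"
  shows "real (nodal_domain_size G f 1) + real (nodal_domain_size G f 2)
           \<ge> (1 - 2 * spectral_expansion G vs / (real d - spectral_expansion G vs)) * real n"
proof -
  interpret pair_graph G by fact
  define V E lam A where "V = pverts G" and "E = parcs G" and "lam = spectral_expansion G vs"
    and "A = adj_mat G vs"
  have fin: "finite V" using pair_finite_verts by (simp add: V_def)
  have vs: "distinct vs" "set vs = V" using assms(4) by (simp_all add: vertex_enum_def V_def)
  then have len: "length vs = n" using assms(2) by (metis distinct_card V_def)
  have bij: "bij_betw ((!) vs) {..<n} V" using bij_betw_nth[OF vs(1)] vs(2) len by simp
  have A: "A \<in> carrier_mat n n" by (simp add: A_def adj_mat_def len)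
  have Aij: "A $$ (i, j) = of_bool ((vs ! i, vs ! j) \<in> E)" if "i < n" "j < n" for i j
    using that by (simp add: A_def adj_mat_def len E_def)
  have nth_V: "vs ! i \<in> V" if "i < n" for i using that len vs(2) nth_mem by metis
  have E_sym: "(u, v) \<in> E \<longleftrightarrow> (v, u) \<in> E" for u v
    unfolding E_def using arcs_symmetric by blast
  have row: "(\<Sum>v\<in>V. of_bool ((u, v) \<in> E)) = real d" if u: "u \<in> V" for u
  proof -
    have "out_arcs (with_proj G) u = Pair u ` (V \<inter> {v. (u, v) \<in> E})"
      using in_arcsD2 by (auto simp: out_arcs_def V_def E_def)
    then have "card (V \<inter> {v. (u, v) \<in> E}) = out_degree (with_proj G) u"
      by (simp add: out_degree_def card_image inj_on_def)
    then show ?thesis using assms(3) u fin by (simp add: regular_graph_def V_def)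
  qed
  have row_A: "(\<Sum>j<n. A $$ (i, j)) = real d" if i: "i < n" for i
  proof -
    have "(\<Sum>j<n. A $$ (i, j)) = (\<Sum>j<n. of_bool ((vs ! i, vs ! j) \<in> E))"
      using i by (intro sum.cong refl) (simp add: Aij)
    also have "\<dots> = (\<Sum>v\<in>V. of_bool ((vs ! i, v) \<in> E))" by (rule sum.reindex_bij_betw[OF bij])
    finally show ?thesis using row[OF nth_V[OF i]] by simp
  qed
  obtain mu where mu: "eigenvector A (vec n (\<lambda>i. f (vs ! i))) mu"
    using assms(6) by (auto simp: adj_eigenvector_def A_def len)
  then have "vec n (\<lambda>i. f (vs ! i)) \<noteq> 0\<^sub>v n" using A by (simp add: eigenvector_def)
  then obtain k where k: "k < n" "f (vs ! k) \<noteq> 0" by (auto simp: vec_eq_iff)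
  then have nonzero: "\<exists>u\<in>V. f u \<noteq> 0" using nth_V by blast
  have eig: "(\<Sum>w\<in>V. of_bool ((u, w) \<in> E) * f w) = mu * f u" if u: "u \<in> V" for u
  proof -
    obtain i where i: "i < n" "u = vs ! i" using u vs(2) len by (metis in_set_conv_nth)
    have "mu * f u = (mu \<cdot>\<^sub>v vec n (\<lambda>i. f (vs ! i))) $ i" using i by simp
    also have "\<dots> = (A *\<^sub>v vec n (\<lambda>i. f (vs ! i))) $ i"
      using mu unfolding eigenvector_def by presburger
    also have "\<dots> = (\<Sum>j<n. of_bool ((u, vs ! j) \<in> E) * f (vs ! j))"
      using A i by (simp add: scalar_prod_def lessThan_atLeast0 Aij)
    also have "\<dots> = (\<Sum>w\<in>V. of_bool ((u, w) \<in> E) * f w)" by (rule sum.reindex_bij_betw[OF bij])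
    finally show ?thesis by simp
  qed
  have n: "0 < n" using k(1) by simp
  have lam: "lam = max (rev (sorted_list_of_multiset (proots (char_poly A))) ! 1)
      (- rev (sorted_list_of_multiset (proots (char_poly A))) ! (n - 1))"
    by (simp add: lam_def spectral_expansion_def graph_eig_def A_def assms(2))
  have sym_A: "A $$ (i, j) = A $$ (j, i)" if "i < n" "j < n" for i j
    using that E_sym by (simp add: Aij)
  have diag_A: "A $$ (i, i) = 0" if "i < n" for i
    using that no_loops' by (auto simp: Aij E_def)
  have less: "lam < d" using assms(5) by (simp add: lam_def)
  have lam_nonneg: "0 \<le> lam"
    unfolding lam
    by (rule expansion_bounds_quad_form(1)[OF A n sym_A diag_A row_A less[unfolded lam]])
  have spectral: "\<bar>quad_form {..<n} (\<lambda>i j. A $$ (i, j)) x\<bar> \<le> lam * (\<Sum>i<n. (x i)\<^sup>2)"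
    if "(\<Sum>i<n. x i) = 0" for x
    unfolding lam
    by (rule expansion_bounds_quad_form(2)[OF A n sym_A diag_A row_A less[unfolded lam] that])
  \<comment> \<open>The enumeration \<open>vs\<close> carries the spectral bound from matrix indices
    to vertices.\<close>
  have gap: "\<bar>quad_form V (\<lambda>u v. of_bool ((u, v) \<in> E)) x\<bar> \<le> lam * (\<Sum>v\<in>V. (x v)\<^sup>2)"
    if x: "(\<Sum>v\<in>V. x v) = 0" for x
  proof -
    have "(\<Sum>i<n. x (vs ! i)) = 0"
      using sum.reindex_bij_betw[OF bij, of x] x by simp
    from spectral[OF this]
    have "\<bar>quad_form {..<n} (\<lambda>i j. A $$ (i, j)) (\<lambda>i. x (vs ! i))\<bar> \<le> lam * (\<Sum>i<n. (x (vs ! i))\<^sup>2)" .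
    also have "quad_form {..<n} (\<lambda>i j. A $$ (i, j)) (\<lambda>i. x (vs ! i)) =
        quad_form {..<n} (\<lambda>i j. of_bool ((vs ! i, vs ! j) \<in> E)) (\<lambda>i. x (vs ! i))"
      by (rule quad_form_cong) (simp_all add: Aij)
    also have "\<dots> = quad_form V (\<lambda>u v. of_bool ((u, v) \<in> E)) x"
      by (rule quad_form_reindex[OF bij])
    also have "(\<Sum>i<n. (x (vs ! i))\<^sup>2) = (\<Sum>v\<in>V. (x v)\<^sup>2)"
      by (rule sum.reindex_bij_betw[OF bij])
    finally show ?thesis .
  qed
  have V_ne: "V \<noteq> {}" using n nth_V by blast
  have mixing: "\<bar>real (card V) * (\<Sum>u\<in>U. \<Sum>v\<in>U. of_bool ((u, v) \<in> E)) - real d * (card U)\<^sup>2\<bar>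
      \<le> lam * (real (card U) * (real (card V) - card U))" if "U \<subseteq> V" for U
    using expander_mixing[OF fin V_ne that _ row gap] E_sym by simp
  have large: "\<exists>S\<in>nodal_domains G g. (\<forall>u\<in>verts S. 0 \<le> g u) \<and> (\<exists>w\<in>verts S. 0 < g w) \<and>
      (d + lam) * card {u \<in> V. 0 \<le> g u} - 2 * lam * n \<le> (d - lam) * card (verts S)"
    if "{u \<in> V. 0 \<le> g u} \<noteq> {}" "\<exists>u\<in>V. g u \<noteq> 0"
      "\<And>u. u \<in> V \<Longrightarrow> (\<Sum>w\<in>V. of_bool ((u, w) \<in> E) * g w) = mu * g u" for g
    using large_nonneg_nodal_domain[folded V_def E_def, of g lam d mu] that less row mixing assms(2)
    by (simp add: V_def)
  define P N where "P = {u \<in> V. 0 \<le> f u}" and "N = {u \<in> V. f u \<le> 0}"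
  have pos: "\<exists>S\<in>nodal_domains G f. (\<exists>w\<in>verts S. 0 < f w) \<and>
      (d + lam) * card P - 2 * lam * n \<le> (d - lam) * card (verts S)" if "P \<noteq> {}"
    using large[OF that[unfolded P_def] nonzero eig] unfolding P_def by blast
  have neg: "\<exists>T\<in>nodal_domains G f. (\<forall>u\<in>verts T. f u \<le> 0) \<and>
      (d + lam) * card N - 2 * lam * n \<le> (d - lam) * card (verts T)" if "N \<noteq> {}"
    using large[of "\<lambda>u. - f u"] that nonzero eig
    by (auto simp: N_def nodal_domains_uminus sum_negf)
  let ?s1 = "nodal_domain_size G f 1" and ?s2 = "nodal_domain_size G f 2"
  \<comment> \<open>Zeros of \<open>f\<close> lie in both sets, so this is only an
    inequality.\<close>
  have union: "n \<le> card (P) + card N"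
  proof -
    have "V = P \<union> N" by (auto simp: P_def N_def)
    then show ?thesis using card_Un_le[of "P" N] assms(2) by (simp add: V_def)
  qed
  have "(d + lam) * card (P) - 2 * lam * n + ((d + lam) * card N - 2 * lam * n)
      \<le> (d - lam) * (real ?s1 + real ?s2)"
  proof -
    note size = nodal_domain_size_ge[OF pair_fin_digraph]
    \<comment> \<open>An empty sign set contributes exactly this nonpositive term, so a single nodal
      domain then suffices.\<close>
    have empty: "- 2 * lam * n \<le> 0" using lam_nonneg by simp
    consider "P = {}" "N \<noteq> {}" | "P \<noteq> {}" "N = {}" | "P \<noteq> {}" "N \<noteq> {}"
      using union n by (cases "P = {}"; cases "N = {}") auto
    then show ?thesis
    proof cases
      case 1
      then obtain T where T: "T \<in> nodal_domains G f"
        "(d + lam) * card N - 2 * lam * n \<le> (d - lam) * card (verts T)" using neg by blast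
      have "(d - lam) * card (verts T) \<le> (d - lam) * (real ?s1 + real ?s2)"
        using size(1)[OF T(1)] less by (intro mult_left_mono) auto
      then show ?thesis using T(2) 1(1) empty by simp
    next
      case 2
      then obtain S where S: "S \<in> nodal_domains G f"
        "(d + lam) * card (P) - 2 * lam * n \<le> (d - lam) * card (verts S)" using pos by blast
      have "(d - lam) * card (verts S) \<le> (d - lam) * (real ?s1 + real ?s2)"
        using size(1)[OF S(1)] less by (intro mult_left_mono) auto
      then show ?thesis using S(2) 2(2) empty by simp
    next
      case 3
      obtain S w where S: "S \<in> nodal_domains G f" "w \<in> verts S" "0 < f w"
        "(d + lam) * card (P) - 2 * lam * n \<le> (d - lam) * card (verts S)" using pos 3 by blast
      obtain T where T: "T \<in> nodal_domains G f" "\<forall>u\<in>verts T. f u \<le> 0"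
        "(d + lam) * card N - 2 * lam * n \<le> (d - lam) * card (verts T)" using neg 3 by blast
      \<comment> \<open>Domains of opposite sign may share zeros of \<open>f\<close>; the positive
        vertex of \<open>S\<close> shows that they are different subgraphs.\<close>
      have "S \<noteq> T" using S(2,3) T(2) by force
      then have "card (verts S) + card (verts T) \<le> ?s1 + ?s2" by (rule size(2)[OF S(1) T(1)])
      then have "(d - lam) * (real (card (verts S)) + real (card (verts T)))
          \<le> (d - lam) * (real ?s1 + real ?s2)"
        using less by (intro mult_left_mono) linarith+
      then show ?thesis using S(4) T(3) by (simp add: algebra_simps)
    qed
  qed
  moreover have "(d + lam) * n \<le> (d + lam) * (real (card (P)) + real (card N))"
    using union lam_nonneg by (intro mult_left_mono) linarith+
  \<comment> \<open>Each sign set costs \<open>2 * lam * n\<close>, and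
    \<open>d + lam - 4 * lam = d - 3 * lam\<close>.\<close>
  ultimately have "(d - 3 * lam) * n \<le> (d - lam) * (real ?s1 + real ?s2)"
    by (simp add: algebra_simps)
  moreover have "(1 - 2 * lam / (d - lam)) * n = (d - 3 * lam) * n / (d - lam)"
    using less by (simp add: field_simps)
  ultimately show ?thesis
    using less by (simp add: lam_def[symmetric] divide_le_eq mult.commute)
qed

end
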